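(* Let $A$ be a finite alphabet and let $S$ be a proper subset of an amenable group $G$. Fix $p \in A^S$ and let $U = \{p\}\times A^{G\setminus S} = \{x \in A^G : x|_S = p\}$. Suppose that $\tau \colon A^G \to A^G$ is a non-uniform cellular automaton with finite memory such that $\tau|_U$ is pre-injective. Then for every Følner net $\mathcal{F}$ of $G$, $$\overline{\mathrm{ent}}_{\mathcal F}(\tau(U)) \ \geq\ (1-\overline{d}_{\mathcal F}(S))\log|A|.$$
   Context: $A^G$ is the set of all maps $x\colon G\to A$, with shift action $(gx)(h)=x(g^{-1}h)$ of $G$. A Følner net of $G$ is a family $\mathcal F=(F_i)_{i\in I}$ of nonempty finite subsets of $G$ indexed by a directed set $I$ with $\lim_{i}|F_i\setminus F_ig|/|F_i|=0$ for all $g\in G$; $G$ is amenable if it has a Følner net. A non-uniform cellular automaton (NUCA) with finite memory is a map $\tau\colon A^G\to A^G$ for which there are a finite set $M\subset G$ and a family of maps $s(g)\colon A^M\to A$, $g\in G$, with $\tau(x)(g)=s(g)\big((g^{-1}x)|_M\big)$ for all $x\in A^G$, $g\in G$. Two configurations $x,y\in A^G$ are asymptotic if they coincide outside a finite subset of $G$. $\tau|_U$ is pre-injective if for all asymptotic $x,y\in U$, $\tau(x)=\tau(y)$ implies $x=y$. For $X\subset A^G$ and $F\subset G$, $X_F=\{x|_F : x\in X\}\subset A^F$. For a Følner net $\mathcal F=(F_i)_{i\in I}$, the upper natural mean $\mathcal F$-entropy of $X$ is $\overline{\mathrm{ent}}_{\mathcal F}(X)=\limsup_{i\in I}\frac{\log|X_{F_i}|}{|F_i|}$,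 and the upper natural $\mathcal F$-density of $S\subset G$ is $\overline d_{\mathcal F}(S)=\limsup_{i\in I}\frac{|S\cap F_i|}{|F_i|}$. *)

theory Defs
  imports Complex_Main "HOL-Library.Extended_Real" "HOL-Algebra.Coset"
begin

section \<open>Nets\<close>

definition directed_set :: "'i set \<Rightarrow> 'i rel \<Rightarrow> bool" where
  "directed_set I r \<longleftrightarrow>
     preorder_on I r \<and> I \<noteq> {} \<and> (\<forall>i\<in>I. \<forall>j\<in>I. \<exists>k\<in>I. (i, k) \<in> r \<and> (j, k) \<in> r)"

text \<open>The filter generated by the tails \<open>{j. j \<ge> i}\<close> of a directed set. Limits and upper limits
  of a net are limits and upper limits along this filter; the two lemmas below
  show that these are the usual ones.\<close>

definition net_filter :: "'i set \<Rightarrow> 'i rel \<Rightarrow> 'i filter" where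
  "net_filter I r = (INF i\<in>I. principal (r `` {i}))"

lemma eventually_net_filter:
  assumes "directed_set I r"
  shows "eventually P (net_filter I r) \<longleftrightarrow> (\<exists>i\<in>I. \<forall>j. (i, j) \<in> r \<longrightarrow> P j)"
proof -
  have tr: "trans r" and ne: "I \<noteq> {}"
    and dir: "\<And>i j. i \<in> I \<Longrightarrow> j \<in> I \<Longrightarrow> \<exists>k\<in>I. (i, k) \<in> r \<and> (j, k) \<in> r"
    using assms by (auto simp: directed_set_def preorder_on_def)
  have "eventually P (net_filter I r) \<longleftrightarrow> (\<exists>i\<in>I. eventually P (principal (r `` {i})))"
    unfolding net_filter_def
  proof (rule eventually_INF_base[OF ne])
    fix i j assume "i \<in> I" "j \<in> I"
    then obtain k where "k \<in> I" "(i, k) \<in> r" "(j, k) \<in> r"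
      using dir by blast
    moreover from this have "r `` {k} \<subseteq> r `` {i} \<inter> r `` {j}"
      using tr by (auto dest: transD)
    ultimately show "\<exists>x\<in>I. principal (r `` {x}) \<le> inf (principal (r `` {i})) (principal (r `` {j}))"
      by auto
  qed
  then show ?thesis
    by (auto simp: eventually_principal)
qed

lemma Limsup_net_filter:
  fixes f :: "'i \<Rightarrow> 'a :: complete_lattice"
  assumes "directed_set I r"
  shows "Limsup (net_filter I r) f = (INF i\<in>I. SUP j\<in>r `` {i}. f j)"
proof (rule antisym)
  show "Limsup (net_filter I r) f \<le> (INF i\<in>I. SUP j\<in>r `` {i}. f j)"
  proof (rule INF_greatest)
    fix i assume "i \<in> I"
    then have "eventually (\<lambda>j. (i, j) \<in> r) (net_filter I r)"
      using eventually_net_filter[OF assms] by blast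
    then have "Limsup (net_filter I r) f \<le> (SUP j\<in>{j. (i, j) \<in> r}. f j)"
      unfolding Limsup_def
      by (intro INF_lower2[where i = "\<lambda>j. (i, j) \<in> r"]) auto
    then show "Limsup (net_filter I r) f \<le> (SUP j\<in>r `` {i}. f j)"
      by (simp add: Image_singleton)
  qed
next
  show "(INF i\<in>I. SUP j\<in>r `` {i}. f j) \<le> Limsup (net_filter I r) f"
    unfolding Limsup_def
  proof (rule INF_greatest)
    fix P assume "P \<in> {P. eventually P (net_filter I r)}"
    then obtain i where i: "i \<in> I" "\<forall>j. (i, j) \<in> r \<longrightarrow> P j"
      using eventually_net_filter[OF assms] by blast
    have "(SUP j\<in>r `` {i}. f j) \<le> (SUP j\<in>Collect P. f j)"
      using i(2) by (intro SUP_subset_mono) auto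
    then show "(INF i\<in>I. SUP j\<in>r `` {i}. f j) \<le> (SUP j\<in>Collect P. f j)"
      using i(1) by (rule INF_lower2[rotated])
  qed
qed


section \<open>Foelner nets and amenability\<close>

definition folner_net ::
    "('g, 'm) monoid_scheme \<Rightarrow> 'i set \<Rightarrow> 'i rel \<Rightarrow> ('i \<Rightarrow> 'g set) \<Rightarrow> bool" where
  "folner_net G I r F \<longleftrightarrow>
     directed_set I r \<and>
     (\<forall>i\<in>I. F i \<subseteq> carrier G \<and> finite (F i) \<and> F i \<noteq> {}) \<and>
     (\<forall>g\<in>carrier G.
        ((\<lambda>i. real (card (F i - (F i #>\<^bsub>G\<^esub> g))) / real (card (F i))) \<longlongrightarrow> 0) (net_filter I r))"

text \<open>A definition cannot quantify over the type of the index set, so the index set is taken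
  in a fixed type. This is no restriction: by \<open>folner_net_imp_amenable\<close>, a Foelner
  net over an index set of any type makes the group amenable.\<close>

definition amenable :: "('g, 'm) monoid_scheme \<Rightarrow> bool" where
  "amenable G \<longleftrightarrow>
     (\<exists>(I :: ('g set \<times> nat) set) (r :: ('g set \<times> nat) rel) F. folner_net G I r F)"

lemma folner_net_imp_amenable:
  assumes "folner_net G I r F"
  shows "amenable G"
proof -
  define q where "q i g = real (card (F i - (F i #>\<^bsub>G\<^esub> g))) / real (card (F i))" for i g
  have dir: "directed_set I r"
    and Fi: "\<And>i. i \<in> I \<Longrightarrow> F i \<subseteq> carrier G \<and> finite (F i) \<and> F i \<noteq> {}"
    and lim: "\<And>g. g \<in> carrier G \<Longrightarrow> ((\<lambda>i. q i g) \<longlongrightarrow> 0) (net_filter I r)"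
    using assms by (auto simp: folner_net_def q_def)
  define J where "J = {K. finite K \<and> K \<subseteq> carrier G} \<times> (UNIV :: nat set)"
  define R where "R = {(a, b). a \<in> J \<and> b \<in> J \<and> fst a \<subseteq> fst b \<and> snd a \<le> snd b}"
  have "\<exists>i\<in>I. \<forall>g\<in>K. q i g < 1 / real (Suc n)" if "finite K" "K \<subseteq> carrier G" for K n
  proof -
    have "eventually (\<lambda>i. \<forall>g\<in>K. q i g < 1 / real (Suc n)) (net_filter I r)"
      using that lim by (intro eventually_ball_finite ballI order_tendstoD(2)[of _ 0]) auto
    then obtain i where i: "i \<in> I" "\<forall>j. (i, j) \<in> r \<longrightarrow> (\<forall>g\<in>K. q j g < 1 / real (Suc n))"
      unfolding eventually_net_filter[OF dir] by (elim bexE)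
    have "(i, i) \<in> r"
      using dir i(1) by (simp add: directed_set_def preorder_on_def refl_on_def)
    with i show ?thesis by (intro bexI[of _ i]) simp_all
  qed
  then have "\<forall>a\<in>J. \<exists>i\<in>I. \<forall>g\<in>fst a. q i g < 1 / real (Suc (snd a))"
    by (auto simp: J_def)
  then obtain c where c: "\<And>a. a \<in> J \<Longrightarrow> c a \<in> I \<and> (\<forall>g\<in>fst a. q (c a) g < 1 / real (Suc (snd a)))"
    using bchoice[of J "\<lambda>a i. i \<in> I \<and> (\<forall>g\<in>fst a. q i g < 1 / real (Suc (snd a)))"] by blast
  have dirJ: "directed_set J R"
    unfolding directed_set_def
  proof (intro conjI ballI)
    show "preorder_on J R"
      unfolding preorder_on_def refl_on_def trans_def R_def by auto
    show "J \<noteq> {}"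
      by (auto simp: J_def)
    fix a b assume ab: "a \<in> J" "b \<in> J"
    let ?k = "(fst a \<union> fst b, max (snd a) (snd b))"
    have "?k \<in> J"
      using ab by (auto simp: J_def)
    then show "\<exists>k\<in>J. (a, k) \<in> R \<and> (b, k) \<in> R"
      using ab by (intro bexI[of _ ?k]) (auto simp: R_def)
  qed
  have "((\<lambda>a. q (c a) g) \<longlongrightarrow> 0) (net_filter J R)" if g: "g \<in> carrier G" for g
  proof (rule order_tendstoI)
    fix e :: real assume "e < 0"
    then have "e < q i h" for i h
      by (rule less_le_trans) (simp add: q_def)
    then show "eventually (\<lambda>a. e < q (c a) g) (net_filter J R)"
      by simp
  next
    fix e :: real assume "0 < e"
    then obtain n where n: "1 / real (Suc n) < e"
      using nat_approx_posE by blast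
    have "q (c b) g < e" if "(({g}, n), b) \<in> R" for b
    proof -
      have b: "b \<in> J" "g \<in> fst b" "n \<le> snd b"
        using that by (auto simp: R_def)
      then have "q (c b) g < 1 / real (Suc (snd b))"
        using c by blast
      also have "\<dots> \<le> 1 / real (Suc n)"
        using b(3) by (simp add: frac_le)
      finally show ?thesis
        using n by simp
    qed
    moreover have "({g}, n) \<in> J"
      using g by (simp add: J_def)
    ultimately show "eventually (\<lambda>a. q (c a) g < e) (net_filter J R)"
      unfolding eventually_net_filter[OF dirJ] by (intro bexI[of _ "({g}, n)"]) simp_all
  qed
  then have "folner_net G J R (\<lambda>a. F (c a))"
    using dirJ c Fi by (auto simp: folner_net_def q_def)
  then show ?thesis
    unfolding amenable_def J_def R_def by blast
qed


section \<open>Configurations and non-uniform cellular automata\<close>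

definition configs :: "('g, 'm) monoid_scheme \<Rightarrow> 'a set \<Rightarrow> ('g \<Rightarrow> 'a) set" where
  "configs G A = carrier G \<rightarrow>\<^sub>E A"

definition shift_action :: "('g, 'm) monoid_scheme \<Rightarrow> 'g \<Rightarrow> ('g \<Rightarrow> 'a) \<Rightarrow> ('g \<Rightarrow> 'a)" where
  "shift_action G g x = (\<lambda>h\<in>carrier G. x (inv\<^bsub>G\<^esub> g \<otimes>\<^bsub>G\<^esub> h))"

text \<open>Only the values of \<open>\<tau>\<close> on \<open>configs G A\<close> and of \<open>s g\<close> on \<open>M \<rightarrow>\<^sub>E A\<close>
  matter.\<close>

definition nuca_finite_memory ::
    "('g, 'm) monoid_scheme \<Rightarrow> 'a set \<Rightarrow> (('g \<Rightarrow> 'a) \<Rightarrow> ('g \<Rightarrow> 'a)) \<Rightarrow> bool" where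
  "nuca_finite_memory G A \<tau> \<longleftrightarrow>
     \<tau> \<in> configs G A \<rightarrow> configs G A \<and>
     (\<exists>M s. finite M \<and> M \<subseteq> carrier G \<and>
        (\<forall>g\<in>carrier G. s g \<in> (M \<rightarrow>\<^sub>E A) \<rightarrow> A) \<and>
        (\<forall>x\<in>configs G A. \<forall>g\<in>carrier G.
           \<tau> x g = s g (restrict (shift_action G (inv\<^bsub>G\<^esub> g) x) M)))"

definition asymptotic :: "('g, 'm) monoid_scheme \<Rightarrow> ('g \<Rightarrow> 'a) \<Rightarrow> ('g \<Rightarrow> 'a) \<Rightarrow> bool" where
  "asymptotic G x y \<longleftrightarrow>
     (\<exists>E. finite E \<and> E \<subseteq> carrier G \<and> (\<forall>g\<in>carrier G - E. x g = y g))"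

definition pre_injective_on ::
    "('g, 'm) monoid_scheme \<Rightarrow> (('g \<Rightarrow> 'a) \<Rightarrow> ('g \<Rightarrow> 'a)) \<Rightarrow> ('g \<Rightarrow> 'a) set \<Rightarrow> bool" where
  "pre_injective_on G \<tau> U \<longleftrightarrow>
     (\<forall>x\<in>U. \<forall>y\<in>U. asymptotic G x y \<longrightarrow> \<tau> x = \<tau> y \<longrightarrow> x = y)"

definition cylinder ::
    "('g, 'm) monoid_scheme \<Rightarrow> 'a set \<Rightarrow> 'g set \<Rightarrow> ('g \<Rightarrow> 'a) \<Rightarrow> ('g \<Rightarrow> 'a) set" where
  "cylinder G A S p = {x \<in> configs G A. restrict x S = p}"


section \<open>Entropy and density\<close>

definition restrictions :: "('g \<Rightarrow> 'a) set \<Rightarrow> 'g set \<Rightarrow> ('g \<Rightarrow> 'a) set" where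
  "restrictions X E = (\<lambda>x. restrict x E) ` X"

definition upper_mean_entropy ::
    "'i set \<Rightarrow> 'i rel \<Rightarrow> ('i \<Rightarrow> 'g set) \<Rightarrow> ('g \<Rightarrow> 'a) set \<Rightarrow> ereal" where
  "upper_mean_entropy I r F X =
     Limsup (net_filter I r)
       (\<lambda>i. ereal (ln (real (card (restrictions X (F i)))) / real (card (F i))))"

definition upper_density ::
    "'i set \<Rightarrow> 'i rel \<Rightarrow> ('i \<Rightarrow> 'g set) \<Rightarrow> 'g set \<Rightarrow> ereal" where
  "upper_density I r F S =
     Limsup (net_filter I r) (\<lambda>i. ereal (real (card (S \<inter> F i)) / real (card (F i))))"

end

(* For a Foelner set F, let E be the set of all h in F - S with h m^-1 in F for every m in the
   memory set M. Configurations of the cylinder that agree outside E are asymptotic, and their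
   images agree outside F; so pre-injectivity makes the images of these |A|^|E| configurations
   pairwise different on F. Since F - E is contained in the union of S and the sets F - F m, m in M,
   the Foelner condition gives |E| >= |F| - |S Int F| - o(|F|). *)

theory Submission
  imports Defs
begin

section \<open>Cylinders, locality and counting by pre-injectivity\<close>

lemma cylinder_nonempty:
  assumes "A \<noteq> {}" "S \<subseteq> carrier G" "p \<in> S \<rightarrow>\<^sub>E A"
  shows "cylinder G A S p \<noteq> {}"
proof -
  obtain a where a: "a \<in> A"
    using assms(1) by blast
  let ?u = "\<lambda>g\<in>carrier G. if g \<in> S then p g else a"
  have "?u \<in> configs G A"
    using a assms(3) by (auto simp: configs_def)
  moreover have "restrict ?u S = p"
    using assms(2,3) by (intro ext) (auto simp: PiE_def extensional_def)
  ultimately show ?thesis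
    unfolding cylinder_def by blast
qed

lemma finite_restrictions:
  assumes "finite A" "finite B" "B \<subseteq> carrier G" "X \<subseteq> configs G A"
  shows "finite (restrictions X B)"
proof (rule finite_subset)
  show "restrictions X B \<subseteq> B \<rightarrow>\<^sub>E A"
    using assms(3,4) by (fastforce simp: restrictions_def configs_def)
  show "finite (B \<rightarrow>\<^sub>E A)"
    using assms(1,2) by (intro finite_PiE)
qed

text \<open>Shifting by \<open>inv g\<close> and evaluating at m reads the cell g m, so the image at
  g depends only on the window g M. Only this dependence matters below; the local rules, which may
  vary with g, are forgotten.\<close>

lemma nuca_finite_memory_local:
  assumes "group G" "nuca_finite_memory G A \<tau>"
  obtains M where "finite M" "M \<subseteq> carrier G"
    "\<And>x y g. \<lbrakk>x \<in> configs G A; y \<in> configs G A; g \<in> carrier G;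
       \<And>m. m \<in> M \<Longrightarrow> x (g \<otimes>\<^bsub>G\<^esub> m) = y (g \<otimes>\<^bsub>G\<^esub> m)\<rbrakk> \<Longrightarrow> \<tau> x g = \<tau> y g"
proof -
  interpret group G by fact
  obtain M s where M: "finite M" "M \<subseteq> carrier G"
    and s: "\<And>x g. x \<in> configs G A \<Longrightarrow> g \<in> carrier G \<Longrightarrow>
        \<tau> x g = s g (restrict (shift_action G (inv\<^bsub>G\<^esub> g) x) M)"
    using assms(2) unfolding nuca_finite_memory_def by blast
  show ?thesis
  proof (rule that[OF M])
    fix x y g
    assume xy: "x \<in> configs G A" "y \<in> configs G A" and g: "g \<in> carrier G"
      and eq: "\<And>m. m \<in> M \<Longrightarrow> x (g \<otimes>\<^bsub>G\<^esub> m) = y (g \<otimes>\<^bsub>G\<^esub> m)"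
    have "restrict (shift_action G (inv\<^bsub>G\<^esub> g) x) M = restrict (shift_action G (inv\<^bsub>G\<^esub> g) y) M"
      using M(2) g eq by (intro restrict_ext) (auto simp: shift_action_def)
    then show "\<tau> x g = \<tau> y g"
      using s[OF xy(1) g] s[OF xy(2) g] by simp
  qed
qed

text \<open>By \<open>EB\<close>, the window of a cell outside \<open>B\<close> never meets
  \<open>E\<close>, so changes made inside \<open>E\<close> cannot be seen in the image outside
  \<open>B\<close>. Hence the image on \<open>B\<close> fixes the whole image, and pre-injectivity
  recovers the pattern on \<open>E\<close>.\<close>

lemma card_power_le_card_restrictions:
  assumes A: "finite A" "A \<noteq> {}"
    and S: "S \<subseteq> carrier G" "p \<in> S \<rightarrow>\<^sub>E A"
    and \<tau>: "\<tau> \<in> configs G A \<rightarrow> configs G A"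
    and loc: "\<And>x y g. \<lbrakk>x \<in> configs G A; y \<in> configs G A; g \<in> carrier G;
       \<And>m. m \<in> M \<Longrightarrow> x (g \<otimes>\<^bsub>G\<^esub> m) = y (g \<otimes>\<^bsub>G\<^esub> m)\<rbrakk> \<Longrightarrow> \<tau> x g = \<tau> y g"
    and pre: "pre_injective_on G \<tau> (cylinder G A S p)"
    and E: "finite E" "E \<subseteq> carrier G - S"
    and B: "finite B" "B \<subseteq> carrier G"
    and EB: "\<And>g m. g \<in> carrier G \<Longrightarrow> m \<in> M \<Longrightarrow> g \<otimes>\<^bsub>G\<^esub> m \<in> E \<Longrightarrow> g \<in> B"
  shows "card A ^ card E \<le> card (restrictions (\<tau> ` cylinder G A S p) B)"
proof -
  let ?U = "cylinder G A S p"
  obtain u where u: "u \<in> ?U"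
    using cylinder_nonempty[OF A(2) S] by blast
  \<comment> \<open>Paste the pattern \<open>w\<close> on \<open>E\<close> into the fixed background
    \<open>u\<close>. As \<open>E\<close> is disjoint from \<open>S\<close>, the prescribed values
    \<open>p\<close> survive; as \<open>E\<close> is finite, any two such configurations are
    asymptotic.\<close>
  define c where "c w = (\<lambda>g. if g \<in> E then w g else u g)" for w
  have conf: "c w \<in> configs G A" if "w \<in> E \<rightarrow>\<^sub>E A" for w
    using that u E(2) by (auto simp: c_def cylinder_def configs_def PiE_def Pi_def extensional_def)
  have cU: "c w \<in> ?U" if "w \<in> E \<rightarrow>\<^sub>E A" for w
  proof -
    have "restrict (c w) S = restrict u S"
      using E(2) by (intro restrict_ext) (auto simp: c_def)
    then show ?thesis
      using conf[OF that] u by (simp add: cylinder_def)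
  qed
  have "inj_on (\<lambda>w. restrict (\<tau> (c w)) B) (E \<rightarrow>\<^sub>E A)"
  proof (rule inj_onI)
    fix v w
    assume v: "v \<in> E \<rightarrow>\<^sub>E A" and w: "w \<in> E \<rightarrow>\<^sub>E A"
      and eq: "restrict (\<tau> (c v)) B = restrict (\<tau> (c w)) B"
    have "\<tau> (c v) = \<tau> (c w)"
    proof (rule extensionalityI)
      show "\<tau> (c v) \<in> extensional (carrier G)" "\<tau> (c w) \<in> extensional (carrier G)"
        using \<tau> conf[OF v] conf[OF w] by (auto simp: configs_def PiE_def)
      fix g assume g: "g \<in> carrier G"
      show "\<tau> (c v) g = \<tau> (c w) g"
      proof (cases "g \<in> B")
        case True
        then show ?thesis
          using fun_cong[OF eq, of g] by simp
      next
        case False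
        then have "c v (g \<otimes>\<^bsub>G\<^esub> m) = c w (g \<otimes>\<^bsub>G\<^esub> m)" if "m \<in> M" for m
          using EB[OF g that] by (auto simp: c_def)
        then show ?thesis
          by (rule loc[OF conf[OF v] conf[OF w] g])
      qed
    qed
    moreover have "asymptotic G (c v) (c w)"
      unfolding asymptotic_def using E by (intro exI[of _ E]) (auto simp: c_def)
    ultimately have "c v = c w"
      using pre cU[OF v] cU[OF w] by (auto simp: pre_injective_on_def)
    then have "v g = w g" if "g \<in> E" for g
      using that by (metis c_def)
    then show "v = w"
      by (rule PiE_ext[OF v w])
  qed
  moreover have "(\<lambda>w. restrict (\<tau> (c w)) B) ` (E \<rightarrow>\<^sub>E A) \<subseteq> restrictions (\<tau> ` ?U) B"
    using cU by (auto simp: restrictions_def)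
  \<comment> \<open>An infinite set has \<open>card\<close> 0, so the injection alone would not
    bound the cardinality.\<close>
  moreover have "finite (restrictions (\<tau> ` ?U) B)"
    using \<tau> by (intro finite_restrictions[OF A(1) B]) (auto simp: cylinder_def)
  ultimately have "card (E \<rightarrow>\<^sub>E A) \<le> card (restrictions (\<tau> ` ?U) B)"
    by (metis card_inj_on_le)
  then show ?thesis
    using E(1) by (simp add: card_PiE)
qed

section \<open>Size of the inner part of a Foelner set\<close>

text \<open>An element of \<open>F\<close> outside the inner part lies in \<open>S\<close> or misses
  some translate \<open>F #> m\<close>; the union bound does the rest. Using \<open>F #> m\<close>
  in place of the condition on h m^-1 makes each loss literally the numerator of a Foelner
  quotient.\<close>

lemma (in group) card_inner_part_ge:
  assumes "finite F" "finite M" "M \<subseteq> carrier G"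
  shows "real (card {h \<in> F - S. \<forall>m\<in>M. h \<in> F #> m})
    \<ge> real (card F) - real (card (S \<inter> F)) - (\<Sum>m\<in>M. real (card (F - (F #> m))))"
proof -
  let ?E = "{h \<in> F - S. \<forall>m\<in>M. h \<in> F #> m}"
  have "card F \<le> card (?E \<union> (S \<inter> F) \<union> (\<Union>m\<in>M. F - (F #> m)))"
    using assms by (intro card_mono) auto
  also have "\<dots> \<le> card ?E + card (S \<inter> F) + card (\<Union>m\<in>M. F - (F #> m))"
    by (meson add_mono card_Un_le le_trans order_refl)
  also have "\<dots> \<le> card ?E + card (S \<inter> F) + (\<Sum>m\<in>M. card (F - (F #> m)))"
    using card_UN_le[OF assms(2)] by (intro add_left_mono)
  finally have "real (card F) \<le> real (card ?E + card (S \<inter> F) + (\<Sum>m\<in>M. card (F - (F #> m))))"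
    by (rule of_nat_mono)
  then show ?thesis
    by simp
qed

section \<open>Upper limits along a net\<close>

text \<open>By reflexivity every index lies in its own tail, so no tail is empty. This is what lets
  a lower limit be compared with the upper one.\<close>

lemma net_filter_neq_bot:
  assumes "directed_set I r"
  shows "net_filter I r \<noteq> bot"
proof -
  have "\<forall>i\<in>I. (i, i) \<in> r"
    using assms by (auto simp: directed_set_def preorder_on_def refl_on_def)
  then have "\<not> eventually (\<lambda>_. False) (net_filter I r)"
    unfolding eventually_net_filter[OF assms] by blast
  then show ?thesis
    by (auto simp: trivial_limit_def)
qed

text \<open>The analytic end of the argument: \<open>a\<close> will be the density ratio of S,
  \<open>e\<close> the total Foelner defect, \<open>L\<close> the logarithm of the alphabet size and
  \<open>h\<close> the entropy ratio. Eventually \<open>a\<close> barely exceeds its upper limit and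
  \<open>e\<close> is small.\<close>

lemma Limsup_ge_one_minus_Limsup:
  fixes a e h :: "'i \<Rightarrow> real"
  assumes N: "N \<noteq> bot" and L: "0 \<le> L"
    and a: "eventually (\<lambda>i. 0 \<le> a i) N" "eventually (\<lambda>i. a i \<le> 1) N"
    and e: "(e \<longlongrightarrow> 0) N"
    and h: "eventually (\<lambda>i. (1 - a i - e i) * L \<le> h i) N"
  shows "Limsup N (\<lambda>i. ereal (h i)) \<ge> (1 - Limsup N (\<lambda>i. ereal (a i))) * ereal L"
proof -
  \<comment> \<open>The bounds on \<open>a\<close> make its upper limit a real \<open>d\<close>, so
    the subtraction in \<open>ereal\<close> meets no infinity.\<close>
  have "0 \<le> Liminf N (\<lambda>i. ereal (a i))"
    using a(1) by (intro Liminf_bounded) simp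
  also have "\<dots> \<le> Limsup N (\<lambda>i. ereal (a i))"
    by (rule Liminf_le_Limsup[OF N])
  finally have "0 \<le> Limsup N (\<lambda>i. ereal (a i))" .
  moreover have "Limsup N (\<lambda>i. ereal (a i)) \<le> 1"
    using a(2) by (intro Limsup_bounded) simp
  ultimately obtain d where d: "Limsup N (\<lambda>i. ereal (a i)) = ereal d"
    by (cases "Limsup N (\<lambda>i. ereal (a i))") auto
  have "ereal ((1 - d) * L) \<le> Limsup N (\<lambda>i. ereal (h i)) + ereal \<epsilon>" if "0 < \<epsilon>" for \<epsilon> :: real
  proof -
    \<comment> \<open>\<open>a\<close> may exceed \<open>d\<close> by \<delta> and \<open>e\<close>
      may reach \<delta>, which costs at most 2 \<delta> L. The denominator uses L + 1 because L may
      be 0.\<close>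
    define \<delta> where "\<delta> = \<epsilon> / (2 * (L + 1))"
    have \<delta>: "0 < \<delta>" "2 * \<delta> * L \<le> \<epsilon>"
      using that L by (auto simp: \<delta>_def field_simps)
    have "Limsup N (\<lambda>i. ereal (a i)) < ereal (d + \<delta>)"
      using d \<delta>(1) by simp
    then have "eventually (\<lambda>i. ereal (a i) < ereal (d + \<delta>)) N"
      by (rule Limsup_lessD)
    moreover have "eventually (\<lambda>i. e i < \<delta>) N"
      using order_tendstoD(2)[OF e \<delta>(1)] .
    ultimately have "eventually (\<lambda>i. ereal ((1 - d) * L - \<epsilon>) \<le> ereal (h i)) N"
      using h
    proof eventually_elim
      case (elim i)
      have "(1 - d - 2 * \<delta>) * L \<le> (1 - a i - e i) * L"
        using elim L by (intro mult_right_mono) auto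
      then show ?case
        using elim(3) \<delta>(2) by (simp add: algebra_simps)
    qed
    \<comment> \<open>The estimate holds eventually, so it bounds even the lower limit.\<close>
    then have "ereal ((1 - d) * L - \<epsilon>) \<le> Liminf N (\<lambda>i. ereal (h i))"
      by (rule Liminf_bounded)
    also have "\<dots> \<le> Limsup N (\<lambda>i. ereal (h i))"
      by (rule Liminf_le_Limsup[OF N])
    finally show ?thesis
      by (cases "Limsup N (\<lambda>i. ereal (h i))") auto
  qed
  then have "ereal ((1 - d) * L) \<le> Limsup N (\<lambda>i. ereal (h i))"
    by (simp add: ereal_le_epsilon2)
  then show ?thesis
    using d by (simp add: one_ereal_def)
qed

section \<open>The estimate on each Foelner set and its limit\<close>

theorem theorem2:
  fixes G :: "('g, 'm) monoid_scheme"
    and A :: "'a set"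
    and S :: "'g set"
    and p :: "'g \<Rightarrow> 'a"
    and \<tau> :: "('g \<Rightarrow> 'a) \<Rightarrow> ('g \<Rightarrow> 'a)"
    and I :: "'i set"
    and r :: "'i rel"
    and F :: "'i \<Rightarrow> 'g set"
  assumes "finite A"
    and "group G"
    and "amenable G"
    and "S \<subset> carrier G"
    and "p \<in> S \<rightarrow>\<^sub>E A"
    and "nuca_finite_memory G A \<tau>"
    and "pre_injective_on G \<tau> (cylinder G A S p)"
    and "folner_net G I r F"
  shows "upper_mean_entropy I r F (\<tau> ` cylinder G A S p)
           \<ge> (1 - upper_density I r F S) * ereal (ln (real (card A)))"
proof -
  interpret group G by fact
  let ?N = "net_filter I r"
  let ?X = "\<tau> ` cylinder G A S p"
  have dir: "directed_set I r"
    and F: "\<And>i. i \<in> I \<Longrightarrow> F i \<subseteq> carrier G \<and> finite (F i) \<and> F i \<noteq> {}"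
    and lim: "\<And>g. g \<in> carrier G \<Longrightarrow>
      ((\<lambda>i. real (card (F i - (F i #>\<^bsub>G\<^esub> g))) / real (card (F i))) \<longlongrightarrow> 0) ?N"
    using assms(8) by (auto simp: folner_net_def)
  have N: "?N \<noteq> bot"
    by (rule net_filter_neq_bot[OF dir])
  show ?thesis
  proof (cases "A = {}")
    case True
    \<comment> \<open>Both sides vanish, because \<open>ln 0 = 0\<close>.\<close>
    have "cylinder G A S p = {}"
      using True one_closed by (auto simp: cylinder_def configs_def PiE_def Pi_def)
    then show ?thesis
      using True N
      by (simp add: upper_mean_entropy_def restrictions_def Limsup_const flip: zero_ereal_def)
  next
    case False
    obtain M where M: "finite M" "M \<subseteq> carrier G"
      and loc: "\<And>x y g. \<lbrakk>x \<in> configs G A; y \<in> configs G A; g \<in> carrier G;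
         \<And>m. m \<in> M \<Longrightarrow> x (g \<otimes>\<^bsub>G\<^esub> m) = y (g \<otimes>\<^bsub>G\<^esub> m)\<rbrakk> \<Longrightarrow> \<tau> x g = \<tau> y g"
      by (rule nuca_finite_memory_local[OF assms(2,6)]) blast
    have \<tau>: "\<tau> \<in> configs G A \<rightarrow> configs G A"
      using assms(6) by (simp add: nuca_finite_memory_def)
    have cardA: "1 \<le> card A"
      using False assms(1) by (simp add: Suc_le_eq card_gt_0_iff)
    \<comment> \<open>The Foelner condition treats one m at a time; since \<open>M\<close> is
      finite, the sum of these quotients still tends to 0.\<close>
    define e where "e i = (\<Sum>m\<in>M. real (card (F i - (F i #>\<^bsub>G\<^esub> m))) / real (card (F i)))" for i
    define a where "a i = real (card (S \<inter> F i)) / real (card (F i))" for i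
    define h where "h i = ln (real (card (restrictions ?X (F i)))) / real (card (F i))" for i
    have e: "(e \<longlongrightarrow> 0) ?N"
      unfolding e_def using M(2) by (intro tendsto_null_sum lim) auto
    have bound: "0 \<le> a i \<and> a i \<le> 1 \<and> (1 - a i - e i) * ln (real (card A)) \<le> h i"
      if "i \<in> I" for i
    proof -
      have Fi: "F i \<subseteq> carrier G" "finite (F i)" "0 < real (card (F i))"
        using F[OF that] by (auto simp: card_gt_0_iff)
      have "card (S \<inter> F i) \<le> card (F i)"
        using Fi(2) by (intro card_mono) auto
      then have a: "0 \<le> a i" "a i \<le> 1"
        using Fi(3) by (auto simp: a_def)
      define E where "E = {g \<in> F i - S. \<forall>m\<in>M. g \<in> F i #>\<^bsub>G\<^esub> m}"
      have E: "finite E" "E \<subseteq> carrier G - S"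
        using Fi by (auto simp: E_def)
      \<comment> \<open>Membership of g m in \<open>F i #> m\<close> gives g m = k m with k in
        \<open>F i\<close>, and right cancellation yields g = k.\<close>
      have EB: "g \<in> F i" if gm: "g \<in> carrier G" "m \<in> M" "g \<otimes>\<^bsub>G\<^esub> m \<in> E" for g m
      proof -
        obtain k where k: "k \<in> F i" "g \<otimes>\<^bsub>G\<^esub> m = k \<otimes>\<^bsub>G\<^esub> m"
          using gm(2,3) unfolding E_def r_coset_def by blast
        then have "g = k"
          using gm M(2) Fi(1) right_cancel by (metis subsetD)
        with k show ?thesis
          by simp
      qed
      have "card A ^ card E \<le> card (restrictions ?X (F i))"
        by (rule card_power_le_card_restrictions[OF assms(1) False _ assms(5) \<tau> loc assms(7) E Fi(2,1) EB])
          (use assms(4) in auto)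
      then have "real (card A) ^ card E \<le> real (card (restrictions ?X (F i)))"
        by (metis of_nat_le_iff of_nat_power)
      then have "ln (real (card A) ^ card E) \<le> ln (real (card (restrictions ?X (F i))))"
        using cardA by (intro ln_mono) auto
      then have ent: "real (card E) * ln (real (card A)) \<le> ln (real (card (restrictions ?X (F i))))"
        using cardA by (simp add: ln_realpow)
      have "(1 - a i - e i) * real (card (F i))
          = real (card (F i)) - real (card (S \<inter> F i)) - (\<Sum>m\<in>M. real (card (F i - (F i #>\<^bsub>G\<^esub> m))))"
        using Fi(3) by (simp add: a_def e_def algebra_simps flip: sum_divide_distrib)
      also have "\<dots> \<le> real (card E)"
        unfolding E_def by (rule card_inner_part_ge[OF Fi(2) M])
      \<comment> \<open>The factor 1 - a - e may be negative; monotonicity only needs the logarithm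
        to be nonnegative, which holds as \<open>A\<close> is nonempty.\<close>
      finally have "(1 - a i - e i) * real (card (F i)) * ln (real (card A))
          \<le> real (card E) * ln (real (card A))"
        using cardA by (intro mult_right_mono) auto
      also note ent
      finally have "(1 - a i - e i) * ln (real (card A)) \<le> h i"
        using Fi(3) by (simp add: h_def pos_le_divide_eq mult_ac)
      with a show ?thesis
        by simp
    qed
    \<comment> \<open>\<open>bound\<close> is available only for indices in \<open>I\<close>; the
      tails stay in \<open>I\<close> because \<open>r\<close> is a relation on
      \<open>I\<close>.\<close>
    have "eventually (\<lambda>i. i \<in> I) ?N"
    proof -
      have "I \<noteq> {}" "r \<subseteq> I \<times> I"
        using dir by (auto simp: directed_set_def preorder_on_def refl_on_def)
      then show ?thesis
        unfolding eventually_net_filter[OF dir] by blast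
    qed
    then have "eventually (\<lambda>i. 0 \<le> a i \<and> a i \<le> 1 \<and> (1 - a i - e i) * ln (real (card A)) \<le> h i) ?N"
      by eventually_elim (rule bound)
    then have "Limsup ?N (\<lambda>i. ereal (h i)) \<ge> (1 - Limsup ?N (\<lambda>i. ereal (a i))) * ereal (ln (real (card A)))"
      using cardA by (intro Limsup_ge_one_minus_Limsup[OF N _ _ _ e]) (auto simp: eventually_conj_iff)
    then show ?thesis
      by (simp add: upper_mean_entropy_def upper_density_def a_def h_def)
  qed
qed

end
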